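(* Let $(X,\mathcal E)$ be a coarse space, $\bar X:=h_{\mathbb R}(X,\mathcal E)$ be its Higson compactification, $G:=G_{X,\bar X}$ be the permutation group of $\bar X$, and $\mathcal E_G$ be the coarse structure on $X$ generated by the action of the group $G$. (1) If $(X,\mathcal E)$ is finitary, then $\mathcal E\subseteq\mathcal E_G$. (2) If $(X,\mathcal E)$ is metrizable, then $\mathcal E_G\subseteq\mathcal E$. (3) If $(X,\mathcal E)$ is finitary and metrizable, then $\mathcal E=\mathcal E_G$.
   Context: An entourage on a set $X$ is a subset $E\subseteq X\times X$ containing the diagonal $\Delta_X$; $E^{-1}=\{(y,x):(x,y)\in E\}$, $E\circ F=\{(x,z):\exists y\in X,\ (x,y)\in E,\ (y,z)\in F\}$, $E[x]=\{y\in X:(x,y)\in E\}$. A coarse space $(X,\mathcal E)$ is a set $X$ with a family $\mathcal E$ of entourages (its coarse structure) such that $\bigcup\mathcal E=X\times X$; for all $E,F\in\mathcal E$ there is $G\in\mathcal E$ with $E\circ F^{-1}\subseteq G$; and $\Delta_X\subseteq E\subseteq F\in\mathcal E$ implies $E\in\mathcal E$. A set $B\subseteq X$ is bounded if $B\subseteq E[x]$ for some $E\in\mathcal E$, $x\in X$. The coarse space is finitary if $\sup_{x\in X}|E[x]|$ is finite for every $E\in\mathcal E$. It is metrizable if there is a metric $d$ on $X$ such that $\mathcal E$ consists of all entourages contained in $\{(x,y):d(x,y)\le n\}$ for some $n\in\omega$. A function $\varphi:X\to\mathbb R$ is slowly oscillating if for every $\varepsilon>0$ and $E\in\mathcal E$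 there is a bounded set $B\subseteq X$ with $\mathrm{diam}\,\varphi(E[x])<\varepsilon$ for all $x\in X\setminus B$. Let $\mathsf{so}(X,\mathcal E;\mathbb R)$ be the set of all bounded slowly oscillating functions $X\to\mathbb R$. The Higson compactification $h_{\mathbb R}(X,\mathcal E)$ is the closure of the image of the injective map $X\to\mathbb R^{\mathsf{so}(X,\mathcal E;\mathbb R)}$, $x\mapsto(f(x))_f$ (product topology); it is compact Hausdorff. $X$ is identified with its image, and it is then the set of isolated points of $h_{\mathbb R}(X,\mathcal E)$. For a compact Hausdorff space $K$ with set $X$ of isolated points, $\mathcal H(K,X)$ is the group of homeomorphisms $g$ of $K$ with $g(x)=x$ for all $x\in K\setminus X$, and the permutation group of $K$ is $G_{X,K}=\{g{\restriction}X:g\in\mathcal H(K,X)\}$. For a group $G$ of permutations of $X$, $\mathcal E_G$ consists of all entourages on $X$ contained in $E_F:=\{(x,y)\in X\times X:y\in\{x\}\cup\{g(x):g\in F\}\}$ for some finite $F\subseteq G$. *)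

theory Defs
  imports "HOL-Analysis.Analysis"
begin

section \<open>Coarse spaces\<close>

definition entourage :: "'a set \<Rightarrow> ('a \<times> 'a) set \<Rightarrow> bool" where
  "entourage X E \<longleftrightarrow> Id_on X \<subseteq> E \<and> E \<subseteq> X \<times> X"

text \<open>The composition \<open>E \<circ> F = {(x,z). \<exists>y. (x,y) \<in> E \<and> (y,z) \<in> F}\<close> is \<open>E O F\<close>,
  and the ball \<open>E[x] = {y. (x,y) \<in> E}\<close> is \<open>E `` {x}\<close>.\<close>

definition coarse_space :: "'a set \<Rightarrow> ('a \<times> 'a) set set \<Rightarrow> bool" where
  "coarse_space X \<E> \<longleftrightarrow>
     (\<forall>E\<in>\<E>. entourage X E) \<and>
     \<Union>\<E> = X \<times> X \<and>
     (\<forall>E\<in>\<E>. \<forall>F\<in>\<E>. \<exists>G\<in>\<E>. E O F\<inverse> \<subseteq> G) \<and>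
     (\<forall>E F. Id_on X \<subseteq> E \<and> E \<subseteq> F \<and> F \<in> \<E> \<longrightarrow> E \<in> \<E>)"

definition coarse_bounded :: "'a set \<Rightarrow> ('a \<times> 'a) set set \<Rightarrow> 'a set \<Rightarrow> bool" where
  "coarse_bounded X \<E> B \<longleftrightarrow> B \<subseteq> X \<and> (\<exists>E\<in>\<E>. \<exists>x\<in>X. B \<subseteq> E `` {x})"

definition finitary :: "'a set \<Rightarrow> ('a \<times> 'a) set set \<Rightarrow> bool" where
  "finitary X \<E> \<longleftrightarrow>
     (\<forall>E\<in>\<E>. \<exists>n::nat. \<forall>x\<in>X. finite (E `` {x}) \<and> card (E `` {x}) \<le> n)"

definition coarse_metrizable :: "'a set \<Rightarrow> ('a \<times> 'a) set set \<Rightarrow> bool" where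
  "coarse_metrizable X \<E> \<longleftrightarrow>
     (\<exists>d. Metric_space X d \<and>
        \<E> = {E. entourage X E \<and> (\<exists>n::nat. E \<subseteq> {(x, y) \<in> X \<times> X. d x y \<le> real n})})"

section \<open>The Higson compactification\<close>

text \<open>Functions \<open>X \<rightarrow> \<real>\<close> are represented by functions that are \<open>undefined\<close> outside \<open>X\<close>.
  Since \<^const>\<open>diameter\<close> is a real number, with no meaningful value at unbounded sets,
  the condition \<open>diam \<phi>(E[x]) < \<epsilon>\<close> has to include the boundedness of \<open>\<phi>(E[x])\<close>.\<close>

definition slowly_oscillating ::
    "'a set \<Rightarrow> ('a \<times> 'a) set set \<Rightarrow> ('a \<Rightarrow> real) \<Rightarrow> bool" where
  "slowly_oscillating X \<E> \<phi> \<longleftrightarrow>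
     (\<forall>\<epsilon>>0. \<forall>E\<in>\<E>. \<exists>B. coarse_bounded X \<E> B \<and>
        (\<forall>x\<in>X - B. bounded (\<phi> ` (E `` {x})) \<and> diameter (\<phi> ` (E `` {x})) < \<epsilon>))"

definition so_functions :: "'a set \<Rightarrow> ('a \<times> 'a) set set \<Rightarrow> ('a \<Rightarrow> real) set" where
  "so_functions X \<E> =
     {\<phi> \<in> X \<rightarrow>\<^sub>E UNIV. bounded (\<phi> ` X) \<and> slowly_oscillating X \<E> \<phi>}"

definition higson_embedding ::
    "'a set \<Rightarrow> ('a \<times> 'a) set set \<Rightarrow> 'a \<Rightarrow> (('a \<Rightarrow> real) \<Rightarrow> real)" where
  "higson_embedding X \<E> x = (\<lambda>f\<in>so_functions X \<E>. f x)"

definition so_product_topology ::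
    "'a set \<Rightarrow> ('a \<times> 'a) set set \<Rightarrow> (('a \<Rightarrow> real) \<Rightarrow> real) topology" where
  "so_product_topology X \<E> = product_topology (\<lambda>f. euclideanreal) (so_functions X \<E>)"

definition higson_compactification ::
    "'a set \<Rightarrow> ('a \<times> 'a) set set \<Rightarrow> (('a \<Rightarrow> real) \<Rightarrow> real) topology" where
  "higson_compactification X \<E> =
     subtopology (so_product_topology X \<E>)
       (so_product_topology X \<E> closure_of (higson_embedding X \<E> ` X))"

section \<open>Permutation groups and the coarse structures they generate\<close>

definition isolated_points :: "'b topology \<Rightarrow> 'b set" where
  "isolated_points K = {x \<in> topspace K. openin K {x}}"

definition homeomorphisms_fixing_rest :: "'b topology \<Rightarrow> 'b set \<Rightarrow> ('b \<Rightarrow> 'b) set" where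
  "homeomorphisms_fixing_rest K S =
     {g. homeomorphic_map K K g \<and> (\<forall>x \<in> topspace K - S. g x = x)}"

definition permutation_group :: "'b topology \<Rightarrow> ('b \<Rightarrow> 'b) set" where
  "permutation_group K =
     {restrict g (isolated_points K) |g. g \<in> homeomorphisms_fixing_rest K (isolated_points K)}"

text \<open>The permutation group of the Higson compactification acts on the image of the
  embedding of \<open>X\<close>. The next definition transports it to \<open>X\<close> along the embedding,
  making explicit the identification of \<open>X\<close> with its image.\<close>

definition higson_permutation_group ::
    "'a set \<Rightarrow> ('a \<times> 'a) set set \<Rightarrow> ('a \<Rightarrow> 'a) set" where
  "higson_permutation_group X \<E> =
     {p \<in> X \<rightarrow>\<^sub>E X. \<exists>g \<in> permutation_group (higson_compactification X \<E>).
        \<forall>x\<in>X. g (higson_embedding X \<E> x) = higson_embedding X \<E> (p x)}"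

definition orbit_entourage :: "'a set \<Rightarrow> ('a \<Rightarrow> 'a) set \<Rightarrow> ('a \<times> 'a) set" where
  "orbit_entourage X F = {(x, y) \<in> X \<times> X. y \<in> {x} \<union> {g x |g. g \<in> F}}"

definition group_coarse_structure :: "'a set \<Rightarrow> ('a \<Rightarrow> 'a) set \<Rightarrow> ('a \<times> 'a) set set" where
  "group_coarse_structure X G =
     {E. entourage X E \<and> (\<exists>F. finite F \<and> F \<subseteq> G \<and> E \<subseteq> orbit_entourage X F)}"

end

theory Submission
  imports Defs
begin

text \<open>
  An involution \<open>g\<close> of \<open>X\<close> extends to a homeomorphism of the Higson compactification as soon as
  composition with it preserves the bounded slowly oscillating functions; the extension is then
  \<open>q \<mapsto> (f \<mapsto> q (f \<circ> g))\<close>. It fixes the points of the boundary if \<open>f \<circ> g - f\<close> tends to zero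
  there, for each \<open>f\<close>.

  In a finitary space, let \<open>E\<close> be an entourage, which may be taken symmetric. Colour the points
  with finitely many colours so that distinct points within two \<open>E\<close>-steps of each other get
  different colours (\<open>greedy_colouring\<close>). The edges of \<open>E\<close> whose ends carry two prescribed colours
  then form a matching, and swapping the ends of its edges is an involution that moves points only
  within \<open>E\<close>. Slow oscillation makes \<open>f \<circ> g - f\<close> small outside a bounded set, and bounded
  sets are finite, hence invisible from the boundary: such an involution belongs to the group
  (\<open>involution_in_group\<close>). Finitely many of these involutions cover \<open>E\<close>.

  Conversely, let \<open>p\<close> be in the group, with extension \<open>G\<close>, and let \<open>f\<close> be slowly oscillating and
  bounded. On the compactification, the set where \<open>f\<close> and \<open>f \<circ> G\<close> differ by at least one
  is compact and avoids the boundary, so it is a compact set of isolated points and therefore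
  finite (\<open>displaced_values_finite\<close>). In a metric space this bounds the displacement of \<open>p\<close>:
  indicators of balls show that \<open>p\<close> carries only finitely many points into or out of a given
  ball, so if the displacement were unbounded, there would be points \<open>x\<^sub>k\<close> with \<open>x\<^sub>k\<close> and
  \<open>p x\<^sub>k\<close> both going to infinity and with displacement tending to infinity. Ever wider bumps
  around the points \<open>p x\<^sub>k\<close> then have a slowly oscillating supremum (\<open>bump_sup_so\<close>) that is
  one at each \<open>p x\<^sub>k\<close> and zero at each \<open>x\<^sub>k\<close>, a contradiction.
\<close>

section \<open>Greedy colouring of graphs of bounded degree\<close>

text \<open>Running along a well-order, each vertex takes the least colour that none of its earlier
  neighbours has; these are at most \<open>n\<close>, so one of the colours \<open>0, \<dots>, n\<close> is free.\<close>

lemma greedy_colouring: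
  fixes R :: "('a \<times> 'a) set"
  assumes sym: "sym R"
    and deg: "\<And>x. finite (R `` {x}) \<and> card (R `` {x}) \<le> n"
  obtains c :: "'a \<Rightarrow> nat"
  where "\<And>x. c x \<le> n" and "\<And>x y. (x, y) \<in> R \<Longrightarrow> x \<noteq> y \<Longrightarrow> c x \<noteq> c y"
proof -
  obtain r :: "'a rel" where r: "well_order_on UNIV r"
    using well_order_on by blast
  define s where "s = r - Id"
  have wf: "wf s"
    using r by (simp add: s_def well_order_on_def)
  have total: "(x, y) \<in> s \<or> (y, x) \<in> s" if "x \<noteq> y" for x y
    using r that by (auto simp: s_def well_order_on_def linear_order_on_def total_on_def)
  \<comment> \<open>the neighbours of \<open>x\<close> that are coloured before \<open>x\<close>\<close>
  define P where "P x = {y. (y, x) \<in> s \<and> (x, y) \<in> R}" for x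
  define c :: "'a \<Rightarrow> nat" where "c = wfrec s (\<lambda>f x. LEAST k. k \<notin> f ` P x)"
  have c_eq: "c x = (LEAST k. k \<notin> c ` P x)" for x
  proof -
    have "cut c s x ` P x = c ` P x"
      by (rule image_cong) (auto simp: P_def cut_apply)
    moreover have "c x = (LEAST k. k \<notin> cut c s x ` P x)"
      by (rule def_wfrec[OF eq_reflection[OF c_def] wf])
    ultimately show ?thesis by metis
  qed
  have fin: "finite (P x)" "card (P x) \<le> n" for x
  proof -
    have "P x \<subseteq> R `` {x}" by (auto simp: P_def)
    then show "finite (P x)" "card (P x) \<le> n"
      using deg[of x] by (auto intro: finite_subset order_trans[OF card_mono])
  qed
  have free: "\<exists>k\<le>n. k \<notin> c ` P x" for x
  proof (rule ccontr)
    assume "\<not> ?thesis"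
    then have "card {..n} \<le> card (c ` P x)"
      using fin[of x] by (intro card_mono) auto
    also have "\<dots> \<le> n"
      using card_image_le[OF fin(1), of c x] fin(2)[of x] by linarith
    finally show False by simp
  qed
  have le: "c x \<le> n" for x
    using free[of x] by (subst c_eq) (meson Least_le order_trans)
  have notin: "c x \<notin> c ` P x" for x
  proof -
    obtain k where "k \<notin> c ` P x" using free by blast
    then have "(LEAST k. k \<notin> c ` P x) \<notin> c ` P x" by (rule LeastI)
    then show ?thesis by (subst c_eq)
  qed
  have "c x \<noteq> c y" if "(x, y) \<in> R" "x \<noteq> y" for x y
  proof (cases "(y, x) \<in> s")
    case True
    then have "y \<in> P x" using that by (simp add: P_def)
    then show ?thesis using notin[of x] by (metis imageI)
  next
    case False
    then have "(x, y) \<in> s" using total that by blast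
    moreover have "(y, x) \<in> R" using sym that by (meson symD)
    ultimately have "x \<in> P y" by (simp add: P_def)
    then show ?thesis using notin[of y] by (metis imageI)
  qed
  with le show thesis using that by blast
qed

text \<open>The singletons of the points of \<open>C\<close> form an open cover.\<close>

lemma compactin_isolated_finite:
  assumes "compactin K C" "C \<subseteq> isolated_points K"
  shows "finite C"
proof -
  have op: "\<And>U. U \<in> (\<lambda>x. {x}) ` C \<Longrightarrow> openin K U"
    using assms(2) by (auto simp: isolated_points_def)
  obtain F where F: "finite F" "F \<subseteq> (\<lambda>x. {x}) ` C" "C \<subseteq> \<Union>F"
    using compactinD[OF assms(1), where \<U> = "(\<lambda>x. {x}) ` C"] op by blast
  then have "finite (\<Union>F)" by (intro finite_Union) auto
  then show ?thesis using F(3) by (rule rev_finite_subset)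
qed

section \<open>Coarse spaces and slowly oscillating functions\<close>

locale coarse =
  fixes X :: "'a set" and \<E> :: "('a \<times> 'a) set set"
  assumes coarse: "coarse_space X \<E>"
begin

abbreviation "SO \<equiv> so_functions X \<E>"
abbreviation "hX \<equiv> higson_compactification X \<E>"
abbreviation "\<iota> \<equiv> higson_embedding X \<E>"

lemmas coarse_parts = coarse[unfolded coarse_space_def]

lemma entourageD:
  assumes "E \<in> \<E>"
  shows "E \<subseteq> X \<times> X" and "x \<in> X \<Longrightarrow> (x, x) \<in> E"
proof -
  have "entourage X E"
    using coarse_parts[THEN conjunct1] assms by (rule bspec)
  then show "E \<subseteq> X \<times> X" and "x \<in> X \<Longrightarrow> (x, x) \<in> E"
    by (auto simp: entourage_def)
qed

lemma Union_coarse: "\<Union>\<E> = X \<times> X"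
  by (rule coarse_parts[THEN conjunct2, THEN conjunct1])

lemma subset_mem: "Id_on X \<subseteq> E \<Longrightarrow> E \<subseteq> F \<Longrightarrow> F \<in> \<E> \<Longrightarrow> E \<in> \<E>"
  by (rule coarse_parts[THEN conjunct2, THEN conjunct2, THEN conjunct2, rule_format,
        OF conjI, OF _ conjI])

lemma comp_converse_mem:
  assumes "E \<in> \<E>" "F \<in> \<E>"
  shows "E O F\<inverse> \<in> \<E>"
proof -
  obtain G where "G \<in> \<E>" "E O F\<inverse> \<subseteq> G"
    using coarse_parts[THEN conjunct2, THEN conjunct2, THEN conjunct1, rule_format, OF assms]
    by (rule bexE)
  moreover have "Id_on X \<subseteq> E O F\<inverse>"
  proof (rule subrelI)
    fix x y assume "(x, y) \<in> Id_on X"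
    then have "x = y" "x \<in> X" by auto
    then show "(x, y) \<in> E O F\<inverse>"
      using entourageD(2)[OF assms(1)] entourageD(2)[OF assms(2)] by (intro relcompI[of x x]) auto
  qed
  ultimately show ?thesis by (meson subset_mem)
qed

lemma converse_mem:
  assumes "E \<in> \<E>"
  shows "E\<inverse> \<in> \<E>"
proof -
  have "Id_on X \<subseteq> E" using entourageD[OF assms] by auto
  then have "Id_on X \<in> \<E>"
    using assms by (rule subset_mem[OF subset_refl])
  moreover have "Id_on X O E\<inverse> = E\<inverse>"
    using entourageD(1)[OF assms] by blast
  ultimately show ?thesis
    using comp_converse_mem[of "Id_on X" E] assms by simp
qed

lemma comp_mem: "E \<in> \<E> \<Longrightarrow> F \<in> \<E> \<Longrightarrow> E O F \<in> \<E>"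
  using comp_converse_mem[of E "F\<inverse>"] converse_mem[of F] by simp

text \<open>Reflexivity gives \<open>E \<union> F \<subseteq> E O F\<close>.\<close>

lemma Un_mem:
  assumes "E \<in> \<E>" "F \<in> \<E>"
  shows "E \<union> F \<in> \<E>"
proof (rule subset_mem)
  show "E O F \<in> \<E>" using assms by (rule comp_mem)
  show "Id_on X \<subseteq> E \<union> F" "E \<union> F \<subseteq> E O F"
    using entourageD[OF assms(1)] entourageD[OF assms(2)] by fastforce+
qed

lemma bounded_singleton: "x \<in> X \<Longrightarrow> coarse_bounded X \<E> {x}"
proof -
  assume x: "x \<in> X"
  then have "(x, x) \<in> \<Union>\<E>" by (simp add: Union_coarse)
  then show ?thesis using x unfolding coarse_bounded_def by blast
qed

lemma bounded_preimage:
  assumes "coarse_bounded X \<E> B" "E \<in> \<E>"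
  shows "coarse_bounded X \<E> (E\<inverse> `` B)"
proof -
  obtain D x where D: "D \<in> \<E>" "x \<in> X" "B \<subseteq> D `` {x}"
    using assms unfolding coarse_bounded_def by blast
  have "D O E\<inverse> \<in> \<E>" using D assms by (intro comp_converse_mem)
  moreover have "E\<inverse> `` B \<subseteq> (D O E\<inverse>) `` {x}" using D by blast
  moreover have "E\<inverse> `` B \<subseteq> X" using entourageD(1)[OF assms(2)] by blast
  ultimately show ?thesis using D unfolding coarse_bounded_def by blast
qed

text \<open>Since \<open>x \<in> E[x]\<close>, a small diameter of \<open>f(E[x])\<close> amounts, up to a constant factor, to small
  distances from \<open>f x\<close>. This form avoids the supremum in the diameter.\<close>

lemma slowly_oscillating_iff:
  "slowly_oscillating X \<E> f \<longleftrightarrow>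
    (\<forall>\<epsilon>>0. \<forall>E\<in>\<E>. \<exists>B. coarse_bounded X \<E> B \<and> (\<forall>x\<in>X - B. \<forall>y. (x, y) \<in> E \<longrightarrow> \<bar>f y - f x\<bar> \<le> \<epsilon>))"
  (is "_ \<longleftrightarrow> ?R")
proof
  assume L: "slowly_oscillating X \<E> f"
  show ?R
  proof (intro allI ballI impI)
    fix \<epsilon> :: real and E assume "\<epsilon> > 0" and E: "E \<in> \<E>"
    then obtain B where B: "coarse_bounded X \<E> B"
      "\<And>x. x \<in> X - B \<Longrightarrow> bounded (f ` (E `` {x})) \<and> diameter (f ` (E `` {x})) < \<epsilon>"
      using L unfolding slowly_oscillating_def by blast
    have "\<bar>f y - f x\<bar> \<le> \<epsilon>" if "x \<in> X - B" "(x, y) \<in> E" for x y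
    proof -
      have "(x, x) \<in> E" using entourageD(2)[OF E] that by blast
      then have "dist (f y) (f x) \<le> diameter (f ` (E `` {x}))"
        using B(2)[OF that(1)] that by (intro diameter_bounded_bound) auto
      then show ?thesis using B(2)[OF that(1)] by (simp add: dist_real_def)
    qed
    then show "\<exists>B. coarse_bounded X \<E> B \<and> (\<forall>x\<in>X - B. \<forall>y. (x, y) \<in> E \<longrightarrow> \<bar>f y - f x\<bar> \<le> \<epsilon>)"
      using B(1) by blast
  qed
next
  assume R: ?R
  show "slowly_oscillating X \<E> f"
    unfolding slowly_oscillating_def
  proof (intro allI ballI impI)
    fix \<epsilon> :: real and E assume \<epsilon>: "\<epsilon> > 0" and E: "E \<in> \<E>"
    then have "\<epsilon> / 3 > 0" by simp
    with R E obtain B where B: "coarse_bounded X \<E> B"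
      "\<And>x y. x \<in> X - B \<Longrightarrow> (x, y) \<in> E \<Longrightarrow> \<bar>f y - f x\<bar> \<le> \<epsilon> / 3" by meson
    have "bounded (f ` (E `` {x})) \<and> diameter (f ` (E `` {x})) < \<epsilon>" if x: "x \<in> X - B" for x
    proof
      show "bounded (f ` (E `` {x}))"
        unfolding bounded_def
        by (rule exI[of _ "f x"], rule exI[of _ "\<epsilon> / 3"])
          (use B(2)[OF x] in \<open>auto simp: dist_real_def abs_minus_commute\<close>)
      have "diameter (f ` (E `` {x})) \<le> 2 * (\<epsilon> / 3)"
      proof (rule diameter_le)
        show "f ` (E `` {x}) \<noteq> {} \<or> 0 \<le> 2 * (\<epsilon> / 3)" using \<epsilon> by simp
        fix u v assume "u \<in> f ` (E `` {x})" "v \<in> f ` (E `` {x})"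
        then have "\<bar>u - f x\<bar> \<le> \<epsilon> / 3" "\<bar>v - f x\<bar> \<le> \<epsilon> / 3" using B(2)[OF x] by auto
        then show "norm (u - v) \<le> 2 * (\<epsilon> / 3)" unfolding real_norm_def by linarith
      qed
      also have "\<dots> < \<epsilon>" using \<epsilon> by simp
      finally show "diameter (f ` (E `` {x})) < \<epsilon>" .
    qed
    then show "\<exists>B. coarse_bounded X \<E> B \<and>
        (\<forall>x\<in>X - B. bounded (f ` (E `` {x})) \<and> diameter (f ` (E `` {x})) < \<epsilon>)"
      using B(1) by blast
  qed
qed

text \<open>The indicator of \<open>A\<close> vanishes on \<open>E[x]\<close> unless \<open>x\<close> lies in the bounded set \<open>E\<inverse>[A]\<close>.\<close>

lemma indicator_so:
  assumes A: "coarse_bounded X \<E> A"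
  shows "(\<lambda>x\<in>X. of_bool (x \<in> A)) \<in> SO"
proof -
  let ?f = "\<lambda>x\<in>X. of_bool (x \<in> A) :: real"
  have "bounded (?f ` X)"
    by (rule boundedI[of _ 1]) auto
  moreover have "slowly_oscillating X \<E> ?f"
    unfolding slowly_oscillating_iff
  proof (intro allI ballI impI)
    fix \<epsilon> :: real and E assume \<epsilon>: "\<epsilon> > 0" and E: "E \<in> \<E>"
    have "\<bar>?f y - ?f x\<bar> \<le> \<epsilon>" if "x \<in> X - E\<inverse> `` A" "(x, y) \<in> E" for x y
    proof -
      have "y \<notin> A" "x \<notin> A" "y \<in> X" "x \<in> X" using that entourageD[OF E] by auto
      then show ?thesis using \<epsilon> by simp
    qed
    then show "\<exists>B. coarse_bounded X \<E> B \<and> (\<forall>x\<in>X - B. \<forall>y. (x, y) \<in> E \<longrightarrow> \<bar>?f y - ?f x\<bar> \<le> \<epsilon>)"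
      using bounded_preimage[OF A E] by blast
  qed
  ultimately show ?thesis by (simp add: so_functions_def)
qed

text \<open>For \<open>(x, y) \<in> F\<close>, both \<open>g x\<close> and \<open>g y\<close> lie in the ball \<open>(F O E)[x]\<close>, on which \<open>f\<close> varies
  little.\<close>

lemma so_compose:
  assumes f: "f \<in> SO" and E: "E \<in> \<E>" and g: "\<And>x. x \<in> X \<Longrightarrow> (x, g x) \<in> E"
  shows "(\<lambda>x\<in>X. f (g x)) \<in> SO"
proof -
  have gX: "g x \<in> X" if "x \<in> X" for x
    using g[OF that] entourageD(1)[OF E] by blast
  have "bounded ((\<lambda>x\<in>X. f (g x)) ` X)"
    by (rule bounded_subset[of "f ` X"]) (use f gX in \<open>auto simp: so_functions_def\<close>)
  moreover have "slowly_oscillating X \<E> (\<lambda>x\<in>X. f (g x))"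
    unfolding slowly_oscillating_iff
  proof (intro allI ballI impI)
    fix \<epsilon> :: real and F assume "\<epsilon> > 0" and F: "F \<in> \<E>"
    then have "\<epsilon> / 2 > 0" by simp
    moreover have FE: "F O E \<in> \<E>" using F E by (rule comp_mem)
    moreover have "slowly_oscillating X \<E> f" using f by (simp add: so_functions_def)
    ultimately obtain B where B: "coarse_bounded X \<E> B"
      "\<And>x y. x \<in> X - B \<Longrightarrow> (x, y) \<in> F O E \<Longrightarrow> \<bar>f y - f x\<bar> \<le> \<epsilon> / 2"
      unfolding slowly_oscillating_iff by meson
    have "\<bar>(\<lambda>x\<in>X. f (g x)) y - (\<lambda>x\<in>X. f (g x)) x\<bar> \<le> \<epsilon>"
      if "x \<in> X - B" "(x, y) \<in> F" for x y
    proof -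
      have y: "y \<in> X" using that entourageD(1)[OF F] by blast
      have "(x, g y) \<in> F O E" "(x, g x) \<in> F O E"
        using that g[OF y] g[of x] entourageD(2)[OF F, of x] by blast+
      then have "\<bar>f (g y) - f x\<bar> \<le> \<epsilon> / 2" "\<bar>f (g x) - f x\<bar> \<le> \<epsilon> / 2"
        using B(2)[OF that(1)] by blast+
      then have "\<bar>f (g y) - f (g x)\<bar> \<le> \<epsilon>" by linarith
      then show ?thesis using y that by simp
    qed
    then show "\<exists>B. coarse_bounded X \<E> B \<and> (\<forall>x\<in>X - B. \<forall>y. (x, y) \<in> F \<longrightarrow>
        \<bar>(\<lambda>x\<in>X. f (g x)) y - (\<lambda>x\<in>X. f (g x)) x\<bar> \<le> \<epsilon>)"
      using B(1) by blast
  qed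
  ultimately show ?thesis by (simp add: so_functions_def)
qed

section \<open>The Higson compactification\<close>

lemma topspace_hX: "topspace hX = so_product_topology X \<E> closure_of (\<iota> ` X)"
  unfolding higson_compactification_def topspace_subtopology
  by (rule Int_absorb1) (rule closure_of_subset_topspace)

lemma topspace_prod: "topspace (so_product_topology X \<E>) = SO \<rightarrow>\<^sub>E UNIV"
  by (simp add: so_product_topology_def)

lemma emb_in_prod: "\<iota> x \<in> topspace (so_product_topology X \<E>)"
  by (simp add: topspace_prod higson_embedding_def)

lemma emb_in_hX:
  assumes "x \<in> X"
  shows "\<iota> x \<in> topspace hX"
proof -
  have "\<iota> ` X \<subseteq> topspace (so_product_topology X \<E>)" using emb_in_prod by blast
  then show ?thesis
    unfolding topspace_hX using assms by (intro subsetD[OF closure_of_subset]) auto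
qed

lemma emb_apply: "f \<in> SO \<Longrightarrow> \<iota> x f = f x"
  by (simp add: higson_embedding_def)

text \<open>Indicators of singletons separate points.\<close>

lemma emb_inj: "inj_on \<iota> X"
proof (rule inj_onI)
  fix x y assume x: "x \<in> X" and y: "y \<in> X" and eq: "\<iota> x = \<iota> y"
  let ?f = "\<lambda>z\<in>X. of_bool (z = x) :: real"
  have f: "?f \<in> SO" using indicator_so[OF bounded_singleton[OF x]] by simp
  have "?f x = ?f y"
    using emb_apply[OF f, of x] emb_apply[OF f, of y] eq by simp
  then show "x = y" using x y by (cases "y = x") auto
qed

lemma evaluation_continuous: "f \<in> SO \<Longrightarrow> continuous_map hX euclideanreal (\<lambda>p. p f)"
  unfolding higson_compactification_def so_product_topology_def
  by (rule continuous_map_from_subtopology) (rule continuous_map_product_projection)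

lemma Hausdorff_hX: "Hausdorff_space hX"
  unfolding higson_compactification_def so_product_topology_def
  by (intro Hausdorff_space_subtopology) (simp add: Hausdorff_space_product_topology Hausdorff_space_euclidean)

lemma emb_dense:
  assumes "openin hX U" "p \<in> U"
  shows "\<exists>x\<in>X. \<iota> x \<in> U"
proof -
  obtain T where T: "openin (so_product_topology X \<E>) T" "U = T \<inter> topspace hX"
    using assms(1) unfolding topspace_hX unfolding higson_compactification_def openin_subtopology
    by (elim exE conjE)
  with assms(2) have "p \<in> so_product_topology X \<E> closure_of (\<iota> ` X)" "p \<in> T"
    by (simp_all add: topspace_hX)
  then obtain y where "y \<in> \<iota> ` X" "y \<in> T"
    using T(1) unfolding in_closure_of by blast
  then show ?thesis using T(2) emb_in_hX by blast
qed

text \<open>Each coordinate is a bounded function, so the closure of \<open>X\<close> lies in a product of compact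
  intervals.\<close>

lemma compact_hX: "compact_space hX"
proof -
  have "\<exists>M. \<forall>x\<in>X. \<bar>f x\<bar> \<le> M" if "f \<in> SO" for f
    using that by (auto simp: so_functions_def bounded_iff)
  then obtain M where M: "\<And>f x. f \<in> SO \<Longrightarrow> x \<in> X \<Longrightarrow> \<bar>f x\<bar> \<le> M f" by metis
  let ?C = "\<Pi>\<^sub>E f\<in>SO. {- M f..M f}"
  have "compactin (so_product_topology X \<E>) ?C"
    unfolding so_product_topology_def by (auto simp: compactin_PiE)
  moreover have "so_product_topology X \<E> closure_of (\<iota> ` X) \<subseteq> ?C"
  proof (rule closure_of_minimal)
    show "\<iota> ` X \<subseteq> ?C"
    proof clarify
      fix x assume x: "x \<in> X"
      show "\<iota> x \<in> ?C"
        using M[OF _ x] by (fastforce simp: higson_embedding_def abs_le_iff)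
    qed
    show "closedin (so_product_topology X \<E>) ?C"
      unfolding so_product_topology_def by (auto simp: closedin_product_topology)
  qed
  ultimately have "compactin (so_product_topology X \<E>) (so_product_topology X \<E> closure_of (\<iota> ` X))"
    by (rule closed_compactin) (rule closedin_closure_of)
  then show ?thesis
    unfolding higson_compactification_def by (rule compact_space_subtopology)
qed

text \<open>The points at which the coordinate given by the indicator of \<open>{x}\<close> exceeds one half form an
  open set that contains no point of \<open>X\<close> but \<open>x\<close>; by density of \<open>X\<close> it is a singleton.\<close>

lemma emb_isolated:
  assumes x: "x \<in> X"
  shows "\<iota> x \<in> isolated_points hX"
proof -
  let ?f = "\<lambda>z\<in>X. of_bool (z = x) :: real"
  have f: "?f \<in> SO" using indicator_so[OF bounded_singleton[OF x]] by simp
  let ?U = "{p \<in> topspace hX. p ?f \<in> {1 / 2<..}}"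
  have U: "openin hX ?U"
    by (rule openin_continuous_map_preimage[OF evaluation_continuous[OF f]]) simp
  have xU: "\<iota> x \<in> ?U" using emb_in_hX[OF x] x by (simp add: emb_apply[OF f])
  have "?U \<subseteq> {\<iota> x}"
  proof (rule ccontr)
    assume "\<not> ?U \<subseteq> {\<iota> x}"
    then obtain p where p: "p \<in> ?U - {\<iota> x}" by blast
    have "openin hX (?U - {\<iota> x})"
      using U closedin_Hausdorff_finite[OF Hausdorff_hX, of "{\<iota> x}"] emb_in_hX[OF x]
      by (intro openin_diff) auto
    then obtain y where y: "y \<in> X" "\<iota> y \<in> ?U - {\<iota> x}" using emb_dense p by meson
    then have "?f y > 1 / 2" by (simp add: emb_apply[OF f])
    then have "y = x" using y(1) by (cases "y = x") auto
    then show False using y by blast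
  qed
  then have "?U = {\<iota> x}" using xU by blast
  then show ?thesis using U emb_in_hX[OF x] by (simp add: isolated_points_def)
qed

section \<open>Involutions extending to the Higson compactification\<close>

lemma finitary_bounded_finite:
  assumes "finitary X \<E>" "coarse_bounded X \<E> B"
  shows "finite B"
  using assms unfolding finitary_def coarse_bounded_def by (meson finite_subset)

text \<open>If the extension \<open>G\<close> moved a boundary point \<open>p\<close>, some coordinate \<open>f\<close> would
  satisfy \<open>\<bar>(f \<circ> g) - f\<bar> > e > 0\<close> on a neighbourhood of \<open>p\<close>. Outside a bounded set this
  contradicts the slow oscillation of \<open>f\<close>, and the bounded set, being finite, can be removed from
  the neighbourhood. Involutivity of \<open>g\<close> carries over to \<open>G\<close> and makes \<open>G\<close> a
  homeomorphism.\<close>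

lemma involution_in_group:
  assumes fin: "finitary X \<E>" and E: "E \<in> \<E>" and g: "g \<in> X \<rightarrow>\<^sub>E X"
    and gg: "\<And>x. x \<in> X \<Longrightarrow> g (g x) = x" and gE: "\<And>x. x \<in> X \<Longrightarrow> (x, g x) \<in> E"
  shows "g \<in> higson_permutation_group X \<E>"
proof -
  let ?P = "so_product_topology X \<E>"
  have gX: "g x \<in> X" if "x \<in> X" for x using g that by blast
  define c where "c f = (\<lambda>x\<in>X. f (g x))" for f :: "'a \<Rightarrow> real"
  have c: "c f \<in> SO" if "f \<in> SO" for f
    unfolding c_def using that E gE by (rule so_compose)
  have cc: "c (c f) = f" if "f \<in> SO" for f
  proof
    fix x
    show "c (c f) x = f x"
    proof (cases "x \<in> X")
      case True
      then show ?thesis using gX gg by (simp add: c_def)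
    next
      case False
      moreover have "f \<in> extensional X" using that by (simp add: so_functions_def PiE_def)
      ultimately show ?thesis by (simp add: c_def extensional_def)
    qed
  qed
  define G where "G p = (\<lambda>f\<in>SO. p (c f))" for p :: "('a \<Rightarrow> real) \<Rightarrow> real"
  have G_emb: "G (\<iota> x) = \<iota> (g x)" if "x \<in> X" for x
    unfolding G_def higson_embedding_def
  proof (rule restrict_ext)
    fix f assume f: "f \<in> SO"
    have "c f x = f (g x)" using that by (simp add: c_def)
    then show "(\<lambda>f\<in>SO. f x) (c f) = f (g x)" using c[OF f] by simp
  qed
  have cont: "continuous_map ?P ?P G"
    unfolding so_product_topology_def continuous_map_componentwise
  proof (intro conjI ballI)
    show "G ` topspace (product_topology (\<lambda>f. euclideanreal) SO) \<subseteq> extensional SO"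
      by (auto simp: G_def)
    fix f assume f: "f \<in> SO"
    show "continuous_map (product_topology (\<lambda>f. euclideanreal) SO) euclideanreal (\<lambda>p. G p f)"
      using continuous_map_product_projection[OF c[OF f], of "\<lambda>f. euclideanreal"] f
      by (simp add: G_def)
  qed
  have "G ` topspace hX \<subseteq> topspace hX"
  proof -
    have "G ` topspace hX \<subseteq> ?P closure_of (G ` \<iota> ` X)"
      unfolding topspace_hX by (rule continuous_map_image_closure_subset[OF cont])
    also have "\<dots> \<subseteq> topspace hX"
      unfolding topspace_hX using G_emb gX by (intro closure_of_mono) auto
    finally show ?thesis .
  qed
  then have "continuous_map hX hX G"
    unfolding topspace_hX unfolding higson_compactification_def continuous_map_in_subtopology
    using continuous_map_from_subtopology[OF cont]
    by (auto simp: topspace_subtopology)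
  moreover have ext: "p \<in> extensional SO" if "p \<in> topspace hX" for p
  proof -
    have "p \<in> topspace ?P"
      using that closure_of_subset_topspace unfolding topspace_hX by (rule subsetD[rotated])
    then show ?thesis by (simp add: topspace_prod PiE_def)
  qed
  moreover have "G (G p) = p" if "p \<in> topspace hX" for p
  proof
    fix f
    show "G (G p) f = p f"
      using ext[OF that] c[of f] cc[of f] by (cases "f \<in> SO") (auto simp: G_def extensional_def)
  qed
  ultimately have homeo: "homeomorphic_map hX hX G"
    by (intro homeomorphic_map_involution)
  have fixed: "G p = p" if p: "p \<in> topspace hX - isolated_points hX" for p
  proof
    fix f
    show "G p f = p f"
    proof (cases "f \<in> SO")
      case False
      moreover have "p \<in> extensional SO" using p by (intro ext) simp
      ultimately show ?thesis by (simp add: G_def extensional_def)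
    next
      case f: True
      show ?thesis
      proof (rule ccontr)
        assume "G p f \<noteq> p f"
        then have pos: "\<bar>p (c f) - p f\<bar> > 0" using f by (simp add: G_def)
        define e where "e = \<bar>p (c f) - p f\<bar> / 2"
        have e: "e > 0" "\<bar>p (c f) - p f\<bar> > e" using pos by (auto simp: e_def)
        have "slowly_oscillating X \<E> f" using f by (simp add: so_functions_def)
        then obtain B where B: "coarse_bounded X \<E> B"
          "\<And>x y. x \<in> X - B \<Longrightarrow> (x, y) \<in> E \<Longrightarrow> \<bar>f y - f x\<bar> \<le> e"
          using e(1) E unfolding slowly_oscillating_iff by meson
        have BX: "B \<subseteq> X" using B(1) by (simp add: coarse_bounded_def)
        let ?U = "{q \<in> topspace hX. \<bar>q (c f) - q f\<bar> \<in> {e<..}} - \<iota> ` B"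
        have "continuous_map hX euclideanreal (\<lambda>q. \<bar>q (c f) - q f\<bar>)"
          by (intro continuous_map_real_abs continuous_map_diff evaluation_continuous f c)
        then have "openin hX {q \<in> topspace hX. \<bar>q (c f) - q f\<bar> \<in> {e<..}}"
          by (rule openin_continuous_map_preimage) simp
        moreover have "closedin hX (\<iota> ` B)"
          using finitary_bounded_finite[OF fin B(1)] BX emb_in_hX
          by (intro closedin_Hausdorff_finite[OF Hausdorff_hX]) auto
        ultimately have "openin hX ?U" by (rule openin_diff)
        moreover have "p \<in> ?U" using p e emb_isolated BX by auto
        ultimately obtain x where x: "x \<in> X" "\<iota> x \<in> ?U" using emb_dense by meson
        then have "x \<in> X - B" "\<bar>f (g x) - f x\<bar> > e"
          using emb_apply f c[OF f] by (auto simp: c_def)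
        then show False using B(2)[of x "g x"] gE x(1) by fastforce
      qed
    qed
  qed
  have "restrict G (isolated_points hX) \<in> permutation_group hX"
    unfolding permutation_group_def homeomorphisms_fixing_rest_def using homeo fixed by blast
  moreover have "restrict G (isolated_points hX) (\<iota> x) = \<iota> (g x)" if "x \<in> X" for x
    using emb_isolated[OF that] G_emb[OF that] by simp
  ultimately show ?thesis
    unfolding higson_permutation_group_def using g by blast
qed

section \<open>Finitary coarse structures\<close>

text \<open>Distinct \<open>S\<close>-neighbours of a point are related by \<open>S O S\<close> and hence coloured differently, so for
  each pair of colours \<open>C\<close> the edges of \<open>S\<close> coloured by \<open>C\<close> form a matching \<open>M C\<close>. The
  permutation \<open>g C\<close> swaps the ends of its edges.\<close>

lemma finitary_subset_group:
  assumes fin: "finitary X \<E>"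
  shows "\<E> \<subseteq> group_coarse_structure X (higson_permutation_group X \<E>)"
proof
  fix E assume E: "E \<in> \<E>"
  define S where "S = E \<union> E\<inverse>"
  have S: "S \<in> \<E>" unfolding S_def using E converse_mem[OF E] by (rule Un_mem)
  have symS: "(y, x) \<in> S" if "(x, y) \<in> S" for x y using that by (auto simp: S_def)
  have SX: "x \<in> X" "y \<in> X" if "(x, y) \<in> S" for x y using that entourageD(1)[OF S] by auto
  have SS: "S O S \<in> \<E>" using S S by (rule comp_mem)
  have "sym (S O S)" by (rule symI) (use symS in blast)
  moreover obtain n where n: "\<And>x. x \<in> X \<Longrightarrow> finite ((S O S) `` {x}) \<and> card ((S O S) `` {x}) \<le> n"
    using fin SS unfolding finitary_def by meson
  have "finite ((S O S) `` {x}) \<and> card ((S O S) `` {x}) \<le> n" for x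
  proof (cases "x \<in> X")
    case False
    then have "(S O S) `` {x} = {}" using SX by blast
    then show ?thesis by simp
  qed (rule n)
  ultimately obtain c :: "'a \<Rightarrow> nat" where c_le: "\<And>x. c x \<le> n"
    and c: "\<And>x y. (x, y) \<in> S O S \<Longrightarrow> x \<noteq> y \<Longrightarrow> c x \<noteq> c y"
    using greedy_colouring[of "S O S" n] by metis
  have c': "c x \<noteq> c y" if "(x, y) \<in> S" "x \<noteq> y" for x y
  proof -
    have "(x, x) \<in> S" using SX(1)[OF that(1)] entourageD(2)[OF S] by blast
    then have "(x, y) \<in> S O S" using that(1) by blast
    then show ?thesis using that(2) by (rule c)
  qed
  define M where "M C x y \<longleftrightarrow> (x, y) \<in> S \<and> x \<noteq> y \<and> {c x, c y} = C" for C x y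
  define g where "g C = (\<lambda>x\<in>X. if \<exists>y. M C x y then THE y. M C x y else x)" for C
  have M_sym: "M C y x" if "M C x y" for C x y
    using that symS by (auto simp: M_def insert_commute)
  have M_unique: "y = z" if "M C x y" "M C x z" for C x y z
  proof (rule ccontr)
    assume "y \<noteq> z"
    have xy: "(x, y) \<in> S" "x \<noteq> y" "{c x, c y} = C" and xz: "(x, z) \<in> S" "x \<noteq> z" "{c x, c z} = C"
      using that by (simp_all add: M_def)
    have "c y = c z"
      using c'[OF xy(1,2)] xy(3) xz(3) by (auto simp: doubleton_eq_iff)
    moreover have "(y, z) \<in> S O S" using symS xy(1) xz(1) by blast
    ultimately show False using c \<open>y \<noteq> z\<close> by blast
  qed
  have g_M: "g C x = y" if "M C x y" for C x y
  proof -
    have "(THE y. M C x y) = y" using that M_unique by blast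
    moreover have "x \<in> X" using that SX(1) by (auto simp: M_def)
    ultimately show ?thesis using that by (auto simp: g_def)
  qed
  have g_id: "g C x = x" if "x \<in> X" "\<nexists>y. M C x y" for C x
    unfolding g_def using that by (simp only: restrict_apply' if_False)
  have g_group: "g C \<in> higson_permutation_group X \<E>" for C
  proof (rule involution_in_group[OF fin S])
    have *: "g C (g C x) = x \<and> (x, g C x) \<in> S" if x: "x \<in> X" for x
    proof (cases "\<exists>y. M C x y")
      case True
      then obtain y where y: "M C x y" by blast
      then show ?thesis using g_M[OF y] g_M[OF M_sym[OF y]] by (simp add: M_def)
    next
      case False
      then show ?thesis using g_id[OF x] entourageD(2)[OF S x] by simp
    qed
    then show "g C (g C x) = x" "(x, g C x) \<in> S" if "x \<in> X" for x using that by blast+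
    show "g C \<in> X \<rightarrow>\<^sub>E X"
    proof (rule PiE_I)
      show "g C x \<in> X" if "x \<in> X" for x using *[OF that] SX(2) by blast
      show "g C x = undefined" if "x \<notin> X" for x using that by (simp add: g_def)
    qed
  qed
  have "E \<subseteq> orbit_entourage X (g ` Pow {..n})"
  proof (rule subrelI)
    fix x y assume xy: "(x, y) \<in> E"
    then have xyS: "(x, y) \<in> S" by (simp add: S_def)
    have "y = x \<or> (\<exists>h \<in> g ` Pow {..n}. y = h x)"
    proof (cases "x = y")
      case False
      then have "M {c x, c y} x y" using xyS by (simp add: M_def)
      then have "y = g {c x, c y} x" by (rule g_M[symmetric])
      moreover have "{c x, c y} \<in> Pow {..n}" using c_le by simp
      ultimately show ?thesis by blast
    qed simp
    then show "(x, y) \<in> orbit_entourage X (g ` Pow {..n})"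
      using SX[OF xyS] by (auto simp: orbit_entourage_def)
  qed
  moreover have "entourage X E" using coarse_parts[THEN conjunct1] E by (rule bspec)
  moreover have "finite (g ` Pow {..n})" by simp
  moreover have "g ` Pow {..n} \<subseteq> higson_permutation_group X \<E>" using g_group by blast
  ultimately show "E \<in> group_coarse_structure X (higson_permutation_group X \<E>)"
    unfolding group_coarse_structure_def by blast
qed

section \<open>Permutations in the group against slowly oscillating functions\<close>

text \<open>The extension \<open>G\<close> of \<open>p\<close> is the identity off the isolated points, so the closed set on which
  the coordinate \<open>f\<close> changes by at least one under \<open>G\<close> is a compact set of isolated points.\<close>

lemma displaced_values_finite:
  assumes p: "p \<in> higson_permutation_group X \<E>" and f: "f \<in> SO"
  shows "finite {x \<in> X. \<bar>f x - f (p x)\<bar> \<ge> 1}"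
proof -
  obtain G where G: "homeomorphic_map hX hX G"
      "\<And>q. q \<in> topspace hX - isolated_points hX \<Longrightarrow> G q = q"
      "\<And>x. x \<in> X \<Longrightarrow> restrict G (isolated_points hX) (\<iota> x) = \<iota> (p x)"
    using p unfolding higson_permutation_group_def permutation_group_def
      homeomorphisms_fixing_rest_def by blast
  have G_emb: "G (\<iota> x) = \<iota> (p x)" if "x \<in> X" for x
    using G(3)[OF that] emb_isolated[OF that] by simp
  let ?C = "{q \<in> topspace hX. \<bar>q f - G q f\<bar> \<in> {1..}}"
  have "continuous_map hX hX G" using G(1) by (rule homeomorphic_imp_continuous_map)
  then have "continuous_map hX euclideanreal ((\<lambda>q. q f) \<circ> G)"
    using evaluation_continuous[OF f] by (rule continuous_map_compose)
  then have "continuous_map hX euclideanreal (\<lambda>q. \<bar>q f - G q f\<bar>)"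
    by (intro continuous_map_real_abs continuous_map_diff evaluation_continuous f) (simp add: o_def)
  then have "closedin hX ?C"
    by (rule closedin_continuous_map_preimage) simp
  then have "compactin hX ?C"
    using compact_hX by (intro closedin_compact_space)
  moreover have "?C \<subseteq> isolated_points hX"
    using G(2) by fastforce
  ultimately have "finite ?C"
    using compactin_isolated_finite by blast
  moreover have "\<iota> ` {x \<in> X. \<bar>f x - f (p x)\<bar> \<ge> 1} \<subseteq> ?C"
    using G_emb emb_in_hX by (auto simp: emb_apply[OF f])
  ultimately have "finite (\<iota> ` {x \<in> X. \<bar>f x - f (p x)\<bar> \<ge> 1})"
    by (rule rev_finite_subset)
  then show ?thesis
    by (rule finite_imageD) (rule inj_on_subset[OF emb_inj], blast)
qed

end

section \<open>Metrizable coarse structures\<close>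

locale metric_coarse = coarse X \<E> + Metric_space X d
  for X :: "'a set" and \<E> and d +
  assumes metr: "\<E> = {E. entourage X E \<and> (\<exists>n::nat. E \<subseteq> {(x, y) \<in> X \<times> X. d x y \<le> real n})}"
begin

lemma metric_mem:
  assumes "entourage X E" and "\<And>x y. (x, y) \<in> E \<Longrightarrow> d x y \<le> r"
  shows "E \<in> \<E>"
proof -
  obtain n :: nat where n: "r \<le> n" using real_arch_simple by blast
  have "E \<subseteq> {(x, y) \<in> X \<times> X. d x y \<le> real n}"
    using assms n unfolding entourage_def by force
  then show ?thesis using assms(1) metr by blast
qed

lemma metric_bounded:
  assumes B: "B \<subseteq> X" and a: "a \<in> X" and r: "\<And>x. x \<in> B \<Longrightarrow> d a x \<le> r"
  shows "coarse_bounded X \<E> B"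
proof -
  let ?E = "{(x, y) \<in> X \<times> X. d x y \<le> max r 0}"
  have "?E \<in> \<E>"
    by (rule metric_mem[where r = "max r 0"]) (auto simp: entourage_def Id_on_def)
  moreover have "B \<subseteq> ?E `` {a}" using B a r by fastforce
  ultimately show ?thesis using B a unfolding coarse_bounded_def by blast
qed

text \<open>The \<open>k\<close>-th bump has slope \<open>1 / (k + 1)\<close>. At a given scale \<open>n\<close>, the bumps of large index vary
  by at most \<open>\<epsilon>\<close>, uniformly, and so does their supremum; the finitely many others vanish outside a
  bounded set.\<close>

lemma bump_sup_so:
  fixes y :: "nat \<Rightarrow> 'a"
  assumes y: "\<And>k. y k \<in> X"
  shows "(\<lambda>x\<in>X. SUP k. max 0 (1 - d x (y k) / (real k + 1))) \<in> SO"
proof -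
  define b where "b x k = max 0 (1 - d x (y k) / (real k + 1))" for x k
  define f where "f x = (SUP k. b x k)" for x
  have b01: "0 \<le> b x k" "b x k \<le> 1" for x k
    by (auto simp: b_def)
  have bdd: "bdd_above (range (b x))" for x
    using b01(2) by (intro bdd_aboveI[of _ 1]) auto
  have b_le: "b x k \<le> f x" for x k
    unfolding f_def by (rule cSUP_upper[OF UNIV_I bdd])
  have f01: "0 \<le> f x" "f x \<le> 1" for x
    using order_trans[OF b01(1) b_le] b01(2) by (auto simp: f_def intro: cSUP_least)
  have "bounded ((\<lambda>x\<in>X. f x) ` X)"
    using f01 by (intro boundedI[of _ 1]) auto
  moreover have "slowly_oscillating X \<E> (\<lambda>x\<in>X. f x)"
    unfolding slowly_oscillating_iff
  proof (intro allI ballI impI)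
    fix \<epsilon> :: real and E assume \<epsilon>: "\<epsilon> > 0" and E: "E \<in> \<E>"
    obtain n :: nat where n: "\<And>u v. (u, v) \<in> E \<Longrightarrow> d u v \<le> n"
      using E metr by blast
    obtain N :: nat where N: "real n / \<epsilon> \<le> N" using real_arch_simple by blast
    \<comment> \<open>Only \<open>u\<close> has to avoid the first \<open>N\<close> bumps, whose values at \<open>v\<close> can only help.\<close>
    have step: "f u \<le> f v + \<epsilon>"
      if u: "u \<in> X" and v: "v \<in> X" and uv: "d u v \<le> n"
        and far: "\<And>k. k < N \<Longrightarrow> d u (y k) \<ge> real k + 1" for u v
    proof -
      have "b u k \<le> f v + \<epsilon>" for k
      proof (cases "k < N")
        case True
        then have "b u k = 0" using far by (simp add: b_def)
        then show ?thesis using f01(1)[of v] \<epsilon> by simp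
      next
        case False
        then have "real n / \<epsilon> \<le> real k + 1" using N by linarith
        then have "real n / (real k + 1) \<le> \<epsilon>" using \<epsilon> by (simp add: field_simps)
        moreover have "d v (y k) \<le> real n + d u (y k)"
          using triangle[OF v u y] uv commute[of u v] by (smt (verit))
        then have "d v (y k) / (real k + 1) \<le> real n / (real k + 1) + d u (y k) / (real k + 1)"
          by (simp flip: add_divide_distrib add: divide_right_mono)
        ultimately have "b u k \<le> b v k + \<epsilon>" using \<epsilon> unfolding b_def by linarith
        then show ?thesis using b_le[of v k] by linarith
      qed
      then show ?thesis unfolding f_def[of u] by (intro cSUP_least) auto
    qed
    \<comment> \<open>The margin \<open>n\<close> keeps the \<open>E\<close>-neighbours of points outside \<open>B\<close> off the first \<open>N\<close> bumps.\<close>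
    define B where "B = {x \<in> X. \<exists>k<N. d x (y k) \<le> real k + 1 + n}"
    have "coarse_bounded X \<E> B"
    proof (rule metric_bounded)
      show "B \<subseteq> X" by (auto simp: B_def)
      show "y 0 \<in> X" by (rule y)
      fix x assume "x \<in> B"
      then obtain k where k: "k < N" "d x (y k) \<le> real k + 1 + n" and x: "x \<in> X"
        by (auto simp: B_def)
      have "d (y 0) (y k) \<le> (\<Sum>k<N. d (y 0) (y k))"
        using k(1) by (intro member_le_sum) auto
      then show "d (y 0) x \<le> (\<Sum>k<N. d (y 0) (y k)) + N + 1 + n"
        using triangle[OF y[of 0] y[of k] x] k commute[of x "y k"] by linarith
    qed
    moreover have "\<bar>f v - f x\<bar> \<le> \<epsilon>" if x: "x \<in> X - B" and xv: "(x, v) \<in> E" for x v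
    proof -
      have v: "v \<in> X" and x': "x \<in> X" using xv x entourageD(1)[OF E] by auto
      have far: "d x (y k) > real k + 1 + n" if "k < N" for k
        using x that by (auto simp: B_def not_le)
      have dxv: "d x v \<le> n" using n[OF xv] .
      have "d v (y k) \<ge> real k + 1" if "k < N" for k
        using far[OF that] triangle[OF x' v y[of k]] dxv by linarith
      then have "f v \<le> f x + \<epsilon>" using step[OF v x'] dxv commute[of x v] by simp
      moreover have "d x (y k) \<ge> real k + 1" if "k < N" for k
        using far[OF that] by linarith
      then have "f x \<le> f v + \<epsilon>" using step[OF x' v dxv] by blast
      ultimately show ?thesis by linarith
    qed
    ultimately show "\<exists>B. coarse_bounded X \<E> B \<and> (\<forall>x\<in>X - B. \<forall>v. (x, v) \<in> E \<longrightarrow>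
        \<bar>(\<lambda>x\<in>X. f x) v - (\<lambda>x\<in>X. f x) x\<bar> \<le> \<epsilon>)"
      using entourageD(1)[OF E] by (intro exI[of _ B]) auto
  qed
  ultimately have "(\<lambda>x\<in>X. f x) \<in> SO" by (simp add: so_functions_def)
  then show ?thesis by (simp add: f_def b_def)
qed

text \<open>By the finiteness lemma for the indicator of the ball of radius \<open>R\<close>, only finitely many points
  enter or leave it under \<open>p\<close>; the other points concerned stay inside and move by at most
  \<open>2 * R\<close>.\<close>

lemma displacement_bounded_near_ball:
  assumes p: "p \<in> higson_permutation_group X \<E>" and a: "a \<in> X"
  shows "\<exists>N. \<forall>x\<in>X. d a x \<le> R \<or> d a (p x) \<le> R \<longrightarrow> d x (p x) \<le> N"
proof -
  have pX: "p x \<in> X" if "x \<in> X" for x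
    using p that by (auto simp: higson_permutation_group_def)
  let ?B = "{x \<in> X. d a x \<le> R}"
  let ?f = "\<lambda>x\<in>X. of_bool (x \<in> ?B) :: real"
  let ?S = "{x \<in> X. \<bar>?f x - ?f (p x)\<bar> \<ge> 1}"
  have "?f \<in> SO"
    by (intro indicator_so metric_bounded[of _ a R]) (use a in auto)
  then have fin: "finite ?S" by (rule displaced_values_finite[OF p])
  have "d x (p x) \<le> max (2 * R) (\<Sum>x\<in>?S. d x (p x))"
    if x: "x \<in> X" and or: "d a x \<le> R \<or> d a (p x) \<le> R" for x
  proof (cases "d a x \<le> R \<and> d a (p x) \<le> R")
    case True
    then show ?thesis
      using triangle[OF x a pX[OF x]] commute[of a x] by linarith
  next
    case False
    then have "x \<in> ?S" using x or pX[OF x] by auto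
    then have "d x (p x) \<le> (\<Sum>x\<in>?S. d x (p x))"
      using fin by (intro member_le_sum) auto
    then show ?thesis by linarith
  qed
  then show ?thesis by blast
qed

text \<open>Otherwise, points \<open>x\<^sub>k\<close> of displacement more than \<open>k + 1\<close> are chosen inductively so far out that
  \<open>x\<^sub>k\<close> and \<open>p x\<^sub>k\<close> are remote from all the previous \<open>x\<^sub>i\<close> and \<open>p x\<^sub>i\<close>. Then no
  \<open>x\<^sub>i\<close> meets the bump of radius \<open>k + 1\<close> around any \<open>p x\<^sub>k\<close>, and the supremum of the bumps
  changes by one along \<open>p\<close> at infinitely many points.\<close>

lemma displacement_bounded:
  assumes p: "p \<in> higson_permutation_group X \<E>"
  shows "\<exists>N. \<forall>x\<in>X. d x (p x) \<le> N"
proof (rule ccontr)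
  assume unbounded: "\<not> ?thesis"
  then obtain a where a: "a \<in> X" by blast
  have pX: "p x \<in> X" if "x \<in> X" for x
    using p that by (auto simp: higson_permutation_group_def)
  define lo where "lo x = min (d a x) (d a (p x))" for x
  define hi where "hi x = max (d a x) (d a (p x))" for x
  have far: "\<exists>x. x \<in> X \<and> d x (p x) > K \<and> lo x > R" for K R
  proof -
    obtain N where N: "\<And>x. x \<in> X \<Longrightarrow> d a x \<le> R \<or> d a (p x) \<le> R \<Longrightarrow> d x (p x) \<le> N"
      using displacement_bounded_near_ball[OF p a, of R] by blast
    obtain x where x: "x \<in> X" "d x (p x) > max N K"
      using unbounded by (meson not_le)
    then have "\<not> (d a x \<le> R \<or> d a (p x) \<le> R)" using N[OF x(1)] by linarith
    then show ?thesis using x by (intro exI[of _ x]) (simp add: lo_def)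
  qed
  \<comment> \<open>The summand \<open>real k + 2\<close> is the radius of the bump of index \<open>Suc k\<close>.\<close>
  have "\<exists>x. \<forall>k. (x k \<in> X \<and> d (x k) (p (x k)) > real k + 1) \<and> lo (x (Suc k)) > hi (x k) + real k + 2"
    (is "\<exists>x. \<forall>k. ?P k (x k) \<and> ?Q k (x k) (x (Suc k))")
    by (rule dependent_nat_choice[of ?P ?Q]) (use far in \<open>auto intro: far\<close>)
  then obtain x where x: "\<And>k. x k \<in> X" and disp: "\<And>k. d (x k) (p (x k)) > real k + 1"
    and lohi: "\<And>k. lo (x (Suc k)) > hi (x k) + real k + 2" by blast
  have lo_le_hi: "lo z \<le> hi z" for z by (simp add: lo_def hi_def)
  have gap: "lo (x k) > hi (x i) + real k + 1" if "i < k" for i k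
    using that
  proof (induction k)
    case (Suc k)
    have "hi (x i) + real k + 2 < lo (x (Suc k))"
    proof (cases "i = k")
      case False
      then have "hi (x i) + real k + 1 < lo (x k)" using Suc by simp
      then show ?thesis using lohi[of k] lo_le_hi[of "x k"] by linarith
    qed (use lohi in simp)
    then show ?case by simp
  qed simp
  have sep: "d (x i) (p (x k)) \<ge> real k + 1" for i k
  proof -
    have tri: "d u v \<ge> d a v - d a u" if "u \<in> X" "v \<in> X" for u v
      using triangle[OF a that] by linarith
    consider "i < k" | "i = k" | "k < i" by linarith
    then show ?thesis
    proof cases
      case 1
      have "d a (p (x k)) \<ge> lo (x k)" "d a (x i) \<le> hi (x i)" by (auto simp: lo_def hi_def)
      then show ?thesis using gap[OF 1] tri[OF x[of i] pX[OF x[of k]]] by linarith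
    next
      case 2
      then show ?thesis using disp[of k] by simp
    next
      case 3
      have "d a (x i) \<ge> lo (x i)" "d a (p (x k)) \<le> hi (x k)" by (auto simp: lo_def hi_def)
      then show ?thesis
        using gap[OF 3] tri[OF pX[OF x[of k]] x[of i]] 3 commute[of "x i"] by simp
    qed
  qed
  let ?f = "\<lambda>z\<in>X. SUP k. max 0 (1 - d z (p (x k)) / (real k + 1))"
  have "?f \<in> SO" using pX x by (intro bump_sup_so) auto
  then have "finite {z \<in> X. \<bar>?f z - ?f (p z)\<bar> \<ge> 1}"
    by (rule displaced_values_finite[OF p])
  moreover have "range x \<subseteq> {z \<in> X. \<bar>?f z - ?f (p z)\<bar> \<ge> 1}"
  proof clarify
    fix i
    have "max 0 (1 - d (x i) (p (x k)) / (real k + 1)) = 0" for k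
      using sep[of k i] sep[of i k] by (simp add: divide_simps)
    then have "?f (x i) = 0" using x by simp
    moreover have "?f (p (x i)) \<ge> 1"
    proof -
      let ?b = "\<lambda>k. max 0 (1 - d (p (x i)) (p (x k)) / (real k + 1))"
      have "?b i \<le> (SUP k. ?b k)"
        by (rule cSUP_upper[OF UNIV_I], rule bdd_aboveI[of _ 1]) auto
      moreover have "?b i = 1" using pX x by simp
      ultimately show ?thesis using pX x by simp
    qed
    ultimately have "\<bar>?f (x i) - ?f (p (x i))\<bar> \<ge> 1" by linarith
    then show "x i \<in> X \<and> \<bar>?f (x i) - ?f (p (x i))\<bar> \<ge> 1" by (rule conjI[OF x])
  qed
  ultimately have "finite (range x)" by (rule rev_finite_subset)
  moreover have "inj x"
  proof (rule linorder_injI)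
    fix i k :: nat assume "i < k"
    then show "x i \<noteq> x k" using gap[of i k] lo_le_hi[of "x k"] by force
  qed
  ultimately show False using finite_imageD[of x UNIV] by simp
qed

lemma metrizable_group_subset: "group_coarse_structure X (higson_permutation_group X \<E>) \<subseteq> \<E>"
proof
  fix E assume "E \<in> group_coarse_structure X (higson_permutation_group X \<E>)"
  then obtain F where E: "entourage X E" "E \<subseteq> orbit_entourage X F"
    and F: "finite F" "F \<subseteq> higson_permutation_group X \<E>"
    unfolding group_coarse_structure_def by blast
  have "\<forall>p\<in>F. \<exists>N. \<forall>x\<in>X. d x (p x) \<le> N" using F(2) displacement_bounded by blast
  then obtain N where N: "\<And>p x. p \<in> F \<Longrightarrow> x \<in> X \<Longrightarrow> d x (p x) \<le> N p" by metis
  show "E \<in> \<E>"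
  proof (rule metric_mem[OF E(1)])
    fix x y assume "(x, y) \<in> E"
    then have xy: "x \<in> X" "y = x \<or> (\<exists>p\<in>F. y = p x)"
      using E(2) by (auto simp: orbit_entourage_def)
    show "d x y \<le> (\<Sum>p\<in>F. \<bar>N p\<bar>)"
    proof (cases "y = x")
      case True
      then show ?thesis using xy(1) by (simp add: sum_nonneg)
    next
      case False
      then obtain p where p: "p \<in> F" "y = p x" using xy(2) by blast
      have "\<bar>N p\<bar> \<le> (\<Sum>p\<in>F. \<bar>N p\<bar>)" using F(1) p(1) by (intro member_le_sum) auto
      then show ?thesis using N[OF p(1) xy(1)] unfolding p(2) by linarith
    qed
  qed
qed

end

section \<open>The two coarse structures\<close>

theorem corollary5p2:
  fixes X :: "'a set" and \<E> :: "('a \<times> 'a) set set"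
  assumes "coarse_space X \<E>"
  shows "(finitary X \<E> \<longrightarrow>
            \<E> \<subseteq> group_coarse_structure X (higson_permutation_group X \<E>)) \<and>
         (coarse_metrizable X \<E> \<longrightarrow>
            group_coarse_structure X (higson_permutation_group X \<E>) \<subseteq> \<E>) \<and>
         (finitary X \<E> \<and> coarse_metrizable X \<E> \<longrightarrow>
            \<E> = group_coarse_structure X (higson_permutation_group X \<E>))"
proof -
  interpret coarse X \<E> using assms by (rule coarse.intro)
  have "group_coarse_structure X (higson_permutation_group X \<E>) \<subseteq> \<E>"
    if metr: "coarse_metrizable X \<E>"
  proof -
    obtain d where d: "Metric_space X d"
      "\<E> = {E. entourage X E \<and> (\<exists>n::nat. E \<subseteq> {(x, y) \<in> X \<times> X. d x y \<le> real n})}"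
      using metr unfolding coarse_metrizable_def by (elim exE conjE)
    have "metric_coarse X \<E> d"
      using d by (intro metric_coarse.intro metric_coarse_axioms.intro coarse_axioms)
    then show ?thesis by (rule metric_coarse.metrizable_group_subset)
  qed
  then show ?thesis using finitary_subset_group by blast
qed

end
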